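(* Let $(X,d)$ be a compact metric space, $f\colon X\to X$ a homeomorphism, and $\varphi\colon X\to\mathbb{R}$ a continuous map. Let $x_0\in X$ be a point that is controlled at any scale with a long sparse tail with respect to $\varphi$ and $X$, and let $\mu$ be a measure that is a weak$\ast$ limit of the sequence of empirical measures $(\mu_n(x_0))_n$ of $x_0$. Then for $\mu$-almost every point $x$ the following holds: (1) the forward orbit of $x$ for $f$ is dense in $X$; and (2) $\lim_{n\to\infty}\frac1n\sum_{i=0}^{n-1}\varphi(f^i(x))=\int\varphi\,d\mu$. In particular, for almost every ergodic measure $\nu$ of the ergodic decomposition of $\mu$, assertions (1) and (2) hold for $\nu$-almost every point $x$.
   Context: Empirical measures: $\mu_n(x)=\frac1n\sum_{i=0}^{n-1}\delta(f^i(x))$, where $\delta(y)$ is the Dirac measure at $y$. A "weak$\ast$ limit" of the sequence $(\mu_n(x_0))_n$ means the weak$\ast$ limit of some subsequence. Notation: $[a,b]_{\mathbb{N}}=[a,b]\cap\mathbb{N}$, with $0\in\mathbb{N}$. A component of $S\subset\mathbb{N}$ is an interval of integers $[a,b]_{\mathbb{N}}\subset S$ with $a-1,b+1\notin S$. A set is $\delta$-dense in $X$ if its $\delta$-neighbourhood contains $X$. Scale: a sequence $\mathcal{T}=(T_n)_{n\ge0}$ of positive integers such that there are integers $\kappa_n\ge3$ ($n\ge1$) with $T_n=\kappa_nT_{n-1}$ and $\kappa_{n+1}/\kappa_n\to\infty$; moreover $T_0$ (hence every $T_n$) is a multiple of $3$. Controlling sequence: a sequence $\bar\varepsilon=(\varepsilon_n)_n$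 of positive numbers converging to $0$ with $\sum_n\varepsilon_n<\infty$ and $\prod_n(1-\varepsilon_n)>0$. $\mathcal{T}$-long $\bar\varepsilon$-sparse tail: a set $R_\infty\subset\mathbb{N}$ such that: (a) every component of $R_\infty$ is of the form $[kT_n,(k+1)T_n-1]_{\mathbb{N}}$ for some $k,n$ (it is said to have size $T_n$). Let $R_n$ be the union of the components of size $T_n$ and $R_{n,\infty}=\bigcup_{i\ge n}R_i$; (b) $0\notin R_\infty$; (c) for every interval $I=[kT_n,(k+1)T_n-1]_{\mathbb{N}}$, $n\ge1$, $k\ge0$, not contained in any component of $R_\infty$: (center position) $[kT_n,kT_n+\frac{T_n}{3}]\cap R_{n-1}=\emptyset=[((k+1)T_n-1)-\frac{T_n}{3},(k+1)T_n-1]\cap R_{n-1}$; and (sparseness) $0<\frac{\#(R_{n-1}\cap I)}{T_n}<\varepsilon_n$. Controlled point: $x\in X$ is controlled at any scale with a long sparse tail with respect to $\varphi$ and $X$ if there are a scale $\mathcal{T}$, a controlling sequence $\bar\varepsilon$, a $\mathcal{T}$-long $\bar\varepsilon$-sparse tail $R_\infty$, and decreasing sequences $(\delta_n)_n$, $(\alpha_n)_n$ of positive numbers converging to $0$ such that: (i) for every component $I$ of $R_\infty$ of size $T_n$, the orbit segment $\{f^i(x):i\in I\}$ is $\delta_n$-dense in $X$; (ii) for every interval $I=[kT_n,(k+1)T_n-1]_{\mathbb{N}}$ with $I\not\subset R_{n+1,\infty}$, one has $\frac1{T_n}\sum_{i\in I}\varphi(f^i(x))\in[-\alpha_n,\alpha_n]$.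 *)

theory Defs
  imports "HOL-Probability.Probability"
begin

definition is_scale :: "(nat \<Rightarrow> nat) \<Rightarrow> bool" where
  "is_scale T \<longleftrightarrow>
     (\<forall>n. 0 < T n) \<and> 3 dvd T 0 \<and>
     (\<exists>\<kappa>::nat \<Rightarrow> nat.
        (\<forall>n\<ge>1. 3 \<le> \<kappa> n \<and> T n = \<kappa> n * T (n - 1)) \<and>
        filterlim (\<lambda>n. real (\<kappa> (Suc n)) / real (\<kappa> n)) at_top sequentially)"

definition controlling_sequence :: "(nat \<Rightarrow> real) \<Rightarrow> bool" where
  "controlling_sequence \<epsilon> \<longleftrightarrow>
     (\<forall>n. 0 < \<epsilon> n) \<and> \<epsilon> \<longlonglongrightarrow> 0 \<and> summable \<epsilon> \<and>
     (\<exists>p>0. (\<lambda>n. 1 - \<epsilon> n) has_prod p)"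

text \<open>The disjunct \<open>a = 0\<close> accounts for \<open>a - 1\<close> being truncated subtraction:
  \<open>-1\<close> is never a member of a set of natural numbers.\<close>

definition is_component :: "nat set \<Rightarrow> nat set \<Rightarrow> bool" where
  "is_component S I \<longleftrightarrow>
     (\<exists>a b. a \<le> b \<and> I = {a..b} \<and> I \<subseteq> S \<and> (a = 0 \<or> a - 1 \<notin> S) \<and> b + 1 \<notin> S)"

definition scale_interval :: "(nat \<Rightarrow> nat) \<Rightarrow> nat \<Rightarrow> nat \<Rightarrow> nat set" where
  "scale_interval T n k = {k * T n .. (k + 1) * T n - 1}"

definition tail_level :: "(nat \<Rightarrow> nat) \<Rightarrow> nat set \<Rightarrow> nat \<Rightarrow> nat set" where
  "tail_level T R n = \<Union>{I. is_component R I \<and> card I = T n}"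

definition tail_from :: "(nat \<Rightarrow> nat) \<Rightarrow> nat set \<Rightarrow> nat \<Rightarrow> nat set" where
  "tail_from T R n = (\<Union>i\<in>{n..}. tail_level T R i)"

text \<open>For a scale, every \<open>T n\<close> is a positive multiple of 3, so \<open>T n div 3\<close> is exact
  and no subtraction below is truncated.\<close>

definition long_sparse_tail :: "(nat \<Rightarrow> nat) \<Rightarrow> (nat \<Rightarrow> real) \<Rightarrow> nat set \<Rightarrow> bool" where
  "long_sparse_tail T \<epsilon> R \<longleftrightarrow>
     (\<forall>I. is_component R I \<longrightarrow> (\<exists>k n. I = scale_interval T n k)) \<and>
     0 \<notin> R \<and>
     (\<forall>n\<ge>1. \<forall>k. \<not> (\<exists>J. is_component R J \<and> scale_interval T n k \<subseteq> J) \<longrightarrow>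
        {k * T n .. k * T n + T n div 3} \<inter> tail_level T R (n - 1) = {} \<and>
        {((k + 1) * T n - 1) - T n div 3 .. (k + 1) * T n - 1} \<inter> tail_level T R (n - 1) = {} \<and>
        0 < real (card (tail_level T R (n - 1) \<inter> scale_interval T n k)) / real (T n) \<and>
        real (card (tail_level T R (n - 1) \<inter> scale_interval T n k)) / real (T n) < \<epsilon> n)"

text \<open>The compact metric space \<open>X\<close> is the whole type \<open>'a\<close>; its compactness is an
  explicit hypothesis wherever it is needed.\<close>

definition delta_dense :: "real \<Rightarrow> 'a::metric_space set \<Rightarrow> bool" where
  "delta_dense \<delta> S \<longleftrightarrow> (\<Union>s\<in>S. ball s \<delta>) = UNIV"

definition controlled_long_sparse_tail ::
  "('a::metric_space \<Rightarrow> 'a) \<Rightarrow> ('a \<Rightarrow> real) \<Rightarrow> 'a \<Rightarrow> bool" where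
  "controlled_long_sparse_tail f \<phi> x \<longleftrightarrow>
     (\<exists>T \<epsilon> R \<delta> \<alpha>.
        is_scale T \<and> controlling_sequence \<epsilon> \<and> long_sparse_tail T \<epsilon> R \<and>
        decseq \<delta> \<and> (\<forall>n. 0 < \<delta> n) \<and> \<delta> \<longlonglongrightarrow> 0 \<and>
        decseq \<alpha> \<and> (\<forall>n. 0 < \<alpha> n) \<and> \<alpha> \<longlonglongrightarrow> 0 \<and>
        (\<forall>n I. is_component R I \<and> card I = T n \<longrightarrow> delta_dense (\<delta> n) ((\<lambda>i. (f ^^ i) x) ` I)) \<and>
        (\<forall>n k. \<not> scale_interval T n k \<subseteq> tail_from T R (n + 1) \<longrightarrow>
           (\<Sum>i\<in>scale_interval T n k. \<phi> ((f ^^ i) x)) / real (T n) \<in> {- \<alpha> n .. \<alpha> n}))"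

text \<open>In \<open>empirical_measure\<close>, \<open>return borel y\<close> is the Dirac measure at \<open>y\<close>.\<close>

definition empirical_measure ::
  "('a::topological_space \<Rightarrow> 'a) \<Rightarrow> 'a \<Rightarrow> nat \<Rightarrow> 'a measure" where
  "empirical_measure f x n =
     measure_of UNIV (sets borel)
       (\<lambda>A. (\<Sum>i<n. emeasure (return borel ((f ^^ i) x)) A) / of_nat n)"

lemma sets_empirical_measure [simp]: "sets (empirical_measure f x n) = sets borel"
  unfolding empirical_measure_def using sets.sigma_sets_eq[of borel] by simp

lemma space_empirical_measure [simp]: "space (empirical_measure f x n) = UNIV"
  unfolding empirical_measure_def by simp

lemma emeasure_empirical_measure:
  assumes "A \<in> sets borel"
  shows "emeasure (empirical_measure f x n) A =
    (\<Sum>i<n. emeasure (return borel ((f ^^ i) x)) A) / of_nat n"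
  using empirical_measure_def[of f x n]
proof (rule emeasure_measure_of)
  show "countably_additive (sets (empirical_measure f x n))
      (\<lambda>A. (\<Sum>i<n. emeasure (return borel ((f ^^ i) x)) A) / of_nat n)"
  proof (rule countably_additiveI)
    fix B :: "nat \<Rightarrow> 'a set"
    assume B: "range B \<subseteq> sets (empirical_measure f x n)" "disjoint_family B"
    have "(\<Sum>k. (\<Sum>i<n. emeasure (return borel ((f ^^ i) x)) (B k)) / of_nat n) =
        (\<Sum>i<n. \<Sum>k. emeasure (return borel ((f ^^ i) x)) (B k)) / of_nat n"
      by (simp add: divide_ennreal_def suminf_sum)
    also have "\<dots> = (\<Sum>i<n. emeasure (return borel ((f ^^ i) x)) (\<Union>k. B k)) / of_nat n"
      using B by (subst suminf_emeasure) auto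
    finally show "(\<Sum>k. (\<Sum>i<n. emeasure (return borel ((f ^^ i) x)) (B k)) / of_nat n) =
        (\<Sum>i<n. emeasure (return borel ((f ^^ i) x)) (\<Union>k. B k)) / of_nat n" .
  qed
qed (use assms in \<open>auto simp: positive_def\<close>)

definition weak_star_conv :: "(nat \<Rightarrow> 'a::topological_space measure) \<Rightarrow> 'a measure \<Rightarrow> bool" where
  "weak_star_conv \<mu>s \<mu> \<longleftrightarrow>
     (\<forall>g::'a \<Rightarrow> real. continuous_on UNIV g \<longrightarrow>
        (\<lambda>n. integral\<^sup>L (\<mu>s n) g) \<longlonglongrightarrow> integral\<^sup>L \<mu> g)"

definition weak_star_subseq_limit ::
  "(nat \<Rightarrow> 'a::topological_space measure) \<Rightarrow> 'a measure \<Rightarrow> bool" where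
  "weak_star_subseq_limit \<mu>s \<mu> \<longleftrightarrow> (\<exists>r. strict_mono r \<and> weak_star_conv (\<mu>s \<circ> r) \<mu>)"

definition ergodic_measure :: "('a::topological_space \<Rightarrow> 'a) \<Rightarrow> 'a measure \<Rightarrow> bool" where
  "ergodic_measure f \<nu> \<longleftrightarrow>
     prob_space \<nu> \<and> sets \<nu> = sets borel \<and> f \<in> borel \<rightarrow>\<^sub>M borel \<and> distr \<nu> borel f = \<nu> \<and>
     (\<forall>A\<in>sets borel. f -` A = A \<longrightarrow> emeasure \<nu> A = 0 \<or> emeasure \<nu> A = 1)"

text \<open>An ergodic decomposition of \<open>\<mu>\<close> is represented by a probability measure \<open>P\<close> on the space
  of Borel probability measures, concentrated on the ergodic ones and with barycenter \<open>\<mu>\<close>.\<close>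

definition ergodic_decomposition ::
  "('a::topological_space \<Rightarrow> 'a) \<Rightarrow> 'a measure \<Rightarrow> 'a measure measure \<Rightarrow> bool" where
  "ergodic_decomposition f \<mu> P \<longleftrightarrow>
     prob_space P \<and> sets P = sets (prob_algebra borel) \<and>
     (AE \<nu> in P. ergodic_measure f \<nu>) \<and>
     (\<forall>A\<in>sets borel. emeasure \<mu> A = (\<integral>\<^sup>+ \<nu>. emeasure \<nu> A \<partial>P))"

definition dense_forward_orbit :: "('a::topological_space \<Rightarrow> 'a) \<Rightarrow> 'a \<Rightarrow> bool" where
  "dense_forward_orbit f x \<longleftrightarrow> closure (range (\<lambda>n. (f ^^ n) x)) = UNIV"

end

theory Submission
  imports Defs
begin

text \<open>
  The argument uses no ergodic theorem; it transfers frequency estimates along the orbit of \<open>x\<^sub>0\<close>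
  to \<open>\<mu>\<close>. Two facts carry it.

  First, the levels \<open>\<ge> p\<close> of the tail occupy a proportion at most
  \<open>4 * (\<Sum>j. \<epsilon> (j + p + 1))\<close> of every initial segment of the natural numbers
  (\<open>tail_from_density\<close>), and this bound tends to \<open>0\<close> as \<open>p\<close> grows. Secondly, if the orbit of
  \<open>x\<^sub>0\<close> visits an open set \<open>U\<close> with frequency at most \<open>c\<close>, then \<open>\<mu> U \<le> c\<close>
  (\<open>weak_star_limit_open_le\<close>). It therefore suffices to cover the set of points violating a
  conclusion by open sets of small visiting frequency (\<open>AE_not_of_small_open_cover\<close>).

  For the averages, every block of length \<open>T n\<close> not contained in the levels \<open>> n\<close> has an average of size at
  most \<open>\<alpha> n\<close>. So a long window starting at time \<open>i\<close> has an average larger than \<open>\<eta>\<close> only if these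
  levels have density at least a constant \<open>\<theta>\<close> in it. By a maximal inequality on the integers
  (\<open>maximal_inequality_nat\<close>), the times \<open>i\<close> at which this happens for some window have frequency at
  most \<open>1 / \<theta>\<close> times the density of the levels \<open>> n\<close>, which is small. Hence almost every point has
  averages tending to \<open>0\<close>. The windows starting at time \<open>0\<close> show that the averages of \<open>x\<^sub>0\<close> tend to
  \<open>0\<close> too, so \<open>\<integral> \<phi> \<partial>\<mu> = 0\<close>.

  For the density of orbits, an iterate \<open>f\<^sup>i x\<^sub>0\<close> whose first \<open>2 * T (n + 1)\<close> iterates are not
  \<open>\<delta> n\<close>-dense has \<open>i + T (n + 1)\<close> in the levels \<open>> n\<close> of the tail, because otherwise a component of
  size \<open>T n\<close> lies in that window (\<open>component_ahead\<close>). Such times again have small frequency.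

  The assertion on ergodic components follows since \<open>\<mu>\<close> is their barycentre.
\<close>

section \<open>Scales and sparse tails\<close>

lemma scale_step:
  assumes "is_scale T"
  shows "T n dvd T (Suc n)" "3 * T n \<le> T (Suc n)"
proof -
  obtain \<kappa> where k: "3 \<le> \<kappa> (Suc n)" "T (Suc n) = \<kappa> (Suc n) * T n"
    using assms unfolding is_scale_def by (metis diff_Suc_1 le_add1 plus_1_eq_Suc)
  then show "T n dvd T (Suc n)" "3 * T n \<le> T (Suc n)" by auto
qed

lemma scale_pos: "is_scale T \<Longrightarrow> 0 < T n"
  by (simp add: is_scale_def)

lemma scale_strict_mono:
  assumes "is_scale T"
  shows "strict_mono T"
  unfolding strict_mono_Suc_iff
proof
  fix n
  show "T n < T (Suc n)" using scale_step(2)[OF assms, of n] scale_pos[OF assms, of n] by linarith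
qed

lemma scale_dvd:
  assumes "is_scale T" "m \<le> n"
  shows "T m dvd T n"
  using assms(2) by (induction rule: dec_induct) (auto intro: dvd_trans scale_step(1)[OF assms(1)])

lemma scale_gt_index: "is_scale T \<Longrightarrow> n < T n"
proof (induction n)
  case (Suc n)
  then show ?case using scale_step(2)[of T n] by simp
qed (simp add: scale_pos)

lemma component_eqI:
  assumes "is_component S I" "is_component S J" "i \<in> I" "i \<in> J"
  shows "I = J"
proof -
  obtain a b where I: "I = {a..b}" "I \<subseteq> S" "a = 0 \<or> a - 1 \<notin> S" "b + 1 \<notin> S"
    using assms(1) unfolding is_component_def by blast
  obtain c d where J: "J = {c..d}" "J \<subseteq> S" "c = 0 \<or> c - 1 \<notin> S" "d + 1 \<notin> S"
    using assms(2) unfolding is_component_def by blast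
  have i: "a \<le> i" "i \<le> b" "c \<le> i" "i \<le> d" using assms I J by auto
  have "\<not> a < c"
  proof
    assume "a < c"
    then have "c - 1 \<in> I" using i I(1) by auto
    then show False using I(2) J(3) \<open>a < c\<close> by auto
  qed
  moreover have "\<not> c < a"
  proof
    assume "c < a"
    then have "a - 1 \<in> J" using i J(1) by auto
    then show False using J(2) I(3) \<open>c < a\<close> by auto
  qed
  moreover have "\<not> b < d"
  proof
    assume "b < d"
    then have "b + 1 \<in> J" using i J(1) by auto
    then show False using J(2) I(4) by auto
  qed
  moreover have "\<not> d < b"
  proof
    assume "d < b"
    then have "d + 1 \<in> I" using i I(1) by auto
    then show False using I(2) J(4) by auto
  qed
  ultimately show ?thesis using I(1) J(1) by simp
qed

lemma scale_interval_eq: "is_scale T \<Longrightarrow> scale_interval T n k = {k * T n..<(k + 1) * T n}"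
  using scale_pos[of T n] unfolding scale_interval_def
  by (cases "(k + 1) * T n") (auto simp: atLeastLessThanSuc_atLeastAtMost)

lemma card_scale_interval: "is_scale T \<Longrightarrow> card (scale_interval T n k) = T n"
  by (simp add: scale_interval_eq)

lemma mem_scale_interval: "is_scale T \<Longrightarrow> i \<in> scale_interval T n k \<longleftrightarrow> i div T n = k"
  using scale_pos[of T n]
  by (auto simp: scale_interval_eq div_nat_eqI mult.commute dividend_less_times_div
      times_div_less_eq_dividend)

lemma scale_interval_subset:
  assumes "is_scale T" "m \<le> n" "i \<in> scale_interval T m k" "i \<in> scale_interval T n l"
  shows "scale_interval T m k \<subseteq> scale_interval T n l"
proof
  fix j assume "j \<in> scale_interval T m k"
  with assms have "j div T m = i div T m" "i div T n = l" by (auto simp: mem_scale_interval)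
  moreover obtain q where "T n = T m * q" using scale_dvd[OF assms(1,2)] by (auto elim: dvdE)
  ultimately show "j \<in> scale_interval T n l"
    using assms(1) by (simp add: mem_scale_interval div_mult2_eq)
qed

lemma component_size:
  assumes "is_scale T" "long_sparse_tail T \<epsilon> R" "is_component R J"
  obtains n k where "J = scale_interval T n k" "card J = T n"
  using assms card_scale_interval unfolding long_sparse_tail_def by metis

text \<open>A scale interval of level \<open>p\<close> that meets the complement of the levels \<open>\<ge> p\<close> of the tail
  is one to which centre position and sparseness apply.\<close>

lemma not_in_component:
  assumes "is_scale T" "long_sparse_tail T \<epsilon> R"
    and "i \<in> scale_interval T p k" "i \<notin> tail_from T R p"
  shows "\<not> (\<exists>J. is_component R J \<and> scale_interval T p k \<subseteq> J)"
proof
  assume "\<exists>J. is_component R J \<and> scale_interval T p k \<subseteq> J"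
  then obtain J where J: "is_component R J" "scale_interval T p k \<subseteq> J" by blast
  obtain n l where n: "J = scale_interval T n l" "card J = T n"
    using component_size[OF assms(1,2) J(1)] .
  have "T p \<le> T n"
    using card_mono[OF _ J(2)] n card_scale_interval[OF assms(1)] by (simp add: scale_interval_def)
  then have "p \<le> n" using scale_strict_mono[OF assms(1)] by (simp add: strict_mono_less_eq)
  then have "i \<in> tail_from T R p"
    using J n assms(3) unfolding tail_from_def tail_level_def by blast
  then show False using assms(4) by contradiction
qed

lemma tail_level_subset: "tail_level T R n \<subseteq> R"
  unfolding tail_level_def is_component_def by blast

lemma zero_notin_tail_from: "long_sparse_tail T \<epsilon> R \<Longrightarrow> 0 \<notin> tail_from T R p"
  using tail_level_subset unfolding tail_from_def long_sparse_tail_def by blast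

lemma tail_level_interval_sparse:
  assumes T: "is_scale T" and R: "long_sparse_tail T \<epsilon> R" and e: "\<And>n. 0 < \<epsilon> n"
  shows "real (card (tail_level T R m \<inter> scale_interval T (Suc m) k)) \<le> \<epsilon> (Suc m) * real (T (Suc m))"
proof (cases "\<exists>J. is_component R J \<and> scale_interval T (Suc m) k \<subseteq> J")
  case False
  then have "real (card (tail_level T R m \<inter> scale_interval T (Suc m) k)) / real (T (Suc m)) < \<epsilon> (Suc m)"
    using R unfolding long_sparse_tail_def by (metis diff_Suc_1 le_add1 plus_1_eq_Suc)
  then show ?thesis using scale_pos[OF T, of "Suc m"] by (simp add: divide_simps)
next
  case True
  then obtain J where J: "is_component R J" "scale_interval T (Suc m) k \<subseteq> J" by blast
  have "tail_level T R m \<inter> scale_interval T (Suc m) k = {}"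
  proof (rule ccontr)
    assume "tail_level T R m \<inter> scale_interval T (Suc m) k \<noteq> {}"
    then obtain i I where i: "is_component R I" "card I = T m" "i \<in> I" "i \<in> scale_interval T (Suc m) k"
      unfolding tail_level_def by blast
    then have "I = J" using component_eqI J by blast
    then have "T (Suc m) \<le> T m"
      using card_mono[OF _ J(2)] i J(1) card_scale_interval[OF T, of "Suc m" k]
      by (auto simp: is_component_def)
    then show False using scale_strict_mono[OF T] by (simp add: strict_mono_less_eq)
  qed
  then show ?thesis using e[of "Suc m"] by simp
qed

text \<open>Since \<open>0\<close> lies outside the tail, centre position keeps level \<open>m\<close> out of the
  first third of the first interval of level \<open>m + 1\<close>.\<close>

lemma tail_level_initial_empty:
  assumes T: "is_scale T" and R: "long_sparse_tail T \<epsilon> R" and i: "3 * i \<le> T (Suc m)"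
  shows "i \<notin> tail_level T R m"
proof -
  have "\<not> (\<exists>J. is_component R J \<and> scale_interval T (Suc m) 0 \<subseteq> J)"
    by (rule not_in_component[OF T R, of 0])
       (use zero_notin_tail_from[OF R] in \<open>auto simp: scale_interval_def\<close>)
  then have "{0 * T (Suc m) .. 0 * T (Suc m) + T (Suc m) div 3} \<inter> tail_level T R m = {}"
    using R unfolding long_sparse_tail_def by (metis diff_Suc_1 le_add1 plus_1_eq_Suc)
  moreover have "i \<le> T (Suc m) div 3" using i by simp
  ultimately show ?thesis by auto
qed

text \<open>An initial segment of length at most \<open>T (m + 1) / 3\<close> avoids level \<open>m\<close>; a longer one is covered
  by scale intervals of level \<open>m + 1\<close> of total length at most four times its own.\<close>

lemma tail_level_density:
  assumes T: "is_scale T" and R: "long_sparse_tail T \<epsilon> R" and e: "\<And>n. 0 < \<epsilon> n"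
  shows "real (card (tail_level T R m \<inter> {..<M})) \<le> 4 * \<epsilon> (Suc m) * real M"
proof (cases "3 * M \<le> T (Suc m)")
  case True
  then have "tail_level T R m \<inter> {..<M} = {}"
    using tail_level_initial_empty[OF T R, of _ m] by auto
  then show ?thesis using e[of "Suc m"] by (simp add: less_imp_le)
next
  case False
  let ?T = "T (Suc m)" and ?K = "M div T (Suc m) + 1"
  have "tail_level T R m \<inter> {..<M} \<subseteq> (\<Union>k<?K. tail_level T R m \<inter> scale_interval T (Suc m) k)"
    by (auto simp: mem_scale_interval[OF T] less_Suc_eq_le div_le_mono)
  then have "card (tail_level T R m \<inter> {..<M}) \<le> (\<Sum>k<?K. card (tail_level T R m \<inter> scale_interval T (Suc m) k))"
    by (intro order.trans[OF card_mono card_UN_le]) (auto simp: scale_interval_def)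
  then have "real (card (tail_level T R m \<inter> {..<M}))
      \<le> (\<Sum>k<?K. real (card (tail_level T R m \<inter> scale_interval T (Suc m) k)))"
    by (metis of_nat_le_iff of_nat_sum)
  also have "\<dots> \<le> (\<Sum>k<?K. \<epsilon> (Suc m) * real ?T)"
    by (intro sum_mono tail_level_interval_sparse[OF T R e])
  also have "\<dots> = \<epsilon> (Suc m) * real (?K * ?T)" by (simp add: algebra_simps)
  also have "?K * ?T \<le> 4 * M"
    using False div_times_less_eq_dividend[of M ?T] unfolding distrib_right by linarith
  then have "\<epsilon> (Suc m) * real (?K * ?T) \<le> \<epsilon> (Suc m) * real (4 * M)"
    using e[of "Suc m"] by (intro mult_left_mono) (auto simp del: of_nat_mult of_nat_add)
  finally show ?thesis by simp
qed

text \<open>A bound for the density of the levels \<open>\<ge> p\<close> of the tail in initial segments. The shift by one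
  is due to level \<open>m\<close> being controlled by \<open>\<epsilon> (m + 1)\<close>; the factor \<open>4\<close> is a rounding loss for
  segments that are not unions of scale intervals.\<close>

definition tail_density :: "(nat \<Rightarrow> real) \<Rightarrow> nat \<Rightarrow> real" where
  "tail_density \<epsilon> p = 4 * (\<Sum>j. \<epsilon> (j + Suc p))"

lemma tail_density_tendsto_0:
  assumes "summable \<epsilon>"
  shows "tail_density \<epsilon> \<longlonglongrightarrow> 0"
proof (rule LIMSEQ_I)
  fix r :: real assume "0 < r"
  then obtain N where N: "\<And>n. n \<ge> N \<Longrightarrow> norm (\<Sum>i. \<epsilon> (i + n)) < r / 4"
    using suminf_exist_split[of "r / 4" \<epsilon>] assms by auto
  have "norm (tail_density \<epsilon> n - 0) < r" if "n \<ge> N" for n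
    using N[of "Suc n"] that by (simp add: tail_density_def abs_mult)
  then show "\<exists>N. \<forall>n\<ge>N. norm (tail_density \<epsilon> n - 0) < r" by blast
qed

lemma tail_from_density:
  assumes T: "is_scale T" and R: "long_sparse_tail T \<epsilon> R" and e: "\<And>n. 0 < \<epsilon> n" and s: "summable \<epsilon>"
  shows "real (card (tail_from T R p \<inter> {..<M})) \<le> tail_density \<epsilon> p * real M"
proof -
  \<comment> \<open>Levels \<open>m \<ge> M\<close> do not meet \<open>{..<M}\<close>, as \<open>T m > m\<close>.\<close>
  have "tail_from T R p \<inter> {..<M} \<subseteq> (\<Union>j<M. tail_level T R (j + p) \<inter> {..<M})"
  proof
    fix i assume i: "i \<in> tail_from T R p \<inter> {..<M}"
    then obtain m where m: "p \<le> m" "i \<in> tail_level T R m" "i < M"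
      unfolding tail_from_def by auto
    have "m < M"
    proof (rule ccontr)
      assume "\<not> m < M"
      then have "3 * i \<le> T (Suc m)"
        using m(3) scale_gt_index[OF T, of m] scale_step(2)[OF T, of m] by linarith
      then show False using tail_level_initial_empty[OF T R] m(2) by blast
    qed
    then show "i \<in> (\<Union>j<M. tail_level T R (j + p) \<inter> {..<M})"
      using m by (intro UN_I[of "m - p"]) auto
  qed
  then have "card (tail_from T R p \<inter> {..<M}) \<le> (\<Sum>j<M. card (tail_level T R (j + p) \<inter> {..<M}))"
    by (intro order.trans[OF card_mono card_UN_le]) auto
  then have "real (card (tail_from T R p \<inter> {..<M})) \<le> (\<Sum>j<M. real (card (tail_level T R (j + p) \<inter> {..<M})))"
    by (metis of_nat_le_iff of_nat_sum)
  also have "\<dots> \<le> (\<Sum>j<M. 4 * \<epsilon> (Suc (j + p)) * real M)"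
    by (intro sum_mono tail_level_density[OF T R e])
  also have "\<dots> = 4 * (\<Sum>j<M. \<epsilon> (j + Suc p)) * real M"
    by (simp add: sum_distrib_left sum_distrib_right)
  also have "\<dots> \<le> tail_density \<epsilon> p * real M"
    unfolding tail_density_def
    using sum_le_suminf[of "\<lambda>j. \<epsilon> (j + Suc p)" "{..<M}"] e s
    by (intro mult_right_mono mult_left_mono) (auto simp: less_imp_le summable_iff_shift simp del: add_Suc_right)
  finally show ?thesis .
qed

text \<open>The tail is sparse but nonempty at every level: the scale interval of level \<open>p + 1\<close> containing
  \<open>i + T (p + 1)\<close> lies in \<open>{i..<i + 2 * T (p + 1)}\<close> and contains a component of size \<open>T p\<close>, unless it
  is contained in a component, whose size is then at least \<open>T (p + 1)\<close>.\<close>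

lemma component_ahead:
  assumes T: "is_scale T" and R: "long_sparse_tail T \<epsilon> R"
    and i: "i + T (Suc p) \<notin> tail_from T R (Suc p)"
  obtains J where "is_component R J" "card J = T p" "J \<subseteq> {i..<i + 2 * T (Suc p)}"
proof -
  define k where "k = i div T (Suc p) + 1"
  let ?I = "scale_interval T (Suc p) k"
  have pos: "0 < T (Suc p)" by (rule scale_pos[OF T])
  then have "i + T (Suc p) \<in> ?I" by (simp add: mem_scale_interval[OF T] k_def)
  then have "\<not> (\<exists>J. is_component R J \<and> ?I \<subseteq> J)"
    by (rule not_in_component[OF T R _ i])
  then have "0 < real (card (tail_level T R p \<inter> ?I)) / real (T (Suc p))"
    using R unfolding long_sparse_tail_def by (metis diff_Suc_1 le_add1 plus_1_eq_Suc)
  then have "tail_level T R p \<inter> ?I \<noteq> {}" by auto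
  then obtain j J where J: "is_component R J" "card J = T p" "j \<in> J" "j \<in> ?I"
    unfolding tail_level_def by blast
  obtain n l where n: "J = scale_interval T n l" "card J = T n"
    using component_size[OF T R J(1)] .
  then have "n = p" using J(2) scale_strict_mono[OF T] by (auto simp: strict_mono_eq)
  then have "J \<subseteq> ?I" using scale_interval_subset[OF T, of p "Suc p" j] J n by simp
  also have "?I \<subseteq> {i..<i + 2 * T (Suc p)}"
    using dividend_less_times_div[OF pos, of i] times_div_less_eq_dividend[of "T (Suc p)" i]
    by (auto simp: scale_interval_eq[OF T] k_def algebra_simps)
  finally show thesis using that J by blast
qed

section \<open>Sums along an orbit with controlled blocks\<close>

lemma block_sum_bound:
  fixes u :: "nat \<Rightarrow> real" and \<alpha> B :: real
  assumes "finite I" "0 \<le> \<alpha>" "\<And>i. \<bar>u i\<bar> \<le> B"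
    and "\<not> I \<subseteq> S \<Longrightarrow> \<bar>\<Sum>i\<in>I. u i\<bar> \<le> \<alpha> * card I"
  shows "\<bar>\<Sum>i\<in>I. u i\<bar> \<le> \<alpha> * card I + B * card (S \<inter> I)"
proof -
  have B: "0 \<le> B" using assms(3)[of 0] by linarith
  show ?thesis
  proof (cases "I \<subseteq> S")
    case True
    then have "S \<inter> I = I" by blast
    moreover have "\<bar>\<Sum>i\<in>I. u i\<bar> \<le> (\<Sum>i\<in>I. B)"
      by (rule order.trans[OF sum_abs sum_mono]) (rule assms(3))
    ultimately show ?thesis using assms(2) by (simp add: mult.commute add_increasing)
  next
    case False
    with assms(4) B show ?thesis by (simp add: add_increasing2)
  qed
qed

text \<open>Blocks of length \<open>t\<close> are either controlled by \<open>\<alpha>\<close> or contained in \<open>S\<close>; an arbitrary window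
  differs from a union of blocks by two pieces shorter than \<open>t\<close>.\<close>

lemma window_sum_bound:
  fixes u :: "nat \<Rightarrow> real"
  assumes t: "0 < t" and \<alpha>: "0 \<le> \<alpha>" and B: "\<And>i. \<bar>u i\<bar> \<le> B"
    and block: "\<And>k. \<not> {k * t..<(k + 1) * t} \<subseteq> S \<Longrightarrow> \<bar>\<Sum>i = k * t..<(k + 1) * t. u i\<bar> \<le> \<alpha> * real t"
  shows "\<bar>\<Sum>i = a..<a + N. u i\<bar> \<le> \<alpha> * N + B * card (S \<inter> {a..<a + N}) + (3 * B + \<alpha>) * t"
proof -
  have B0: "0 \<le> B" using B[of 0] by linarith
  have short: "\<bar>\<Sum>i = c..<d. u i\<bar> \<le> B * t" if "c \<le> d" "d - c \<le> t" for c d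
  proof -
    have "\<bar>\<Sum>i = c..<d. u i\<bar> \<le> (\<Sum>i = c..<d. B)"
      by (rule order.trans[OF sum_abs sum_mono]) (rule B)
    also have "\<dots> \<le> B * t" using that B0 by (simp add: mult.commute mult_left_mono)
    finally show ?thesis .
  qed
  have blocks: "\<bar>\<Sum>i = q * t..<(q + n) * t. u i\<bar>
      \<le> \<alpha> * real (n * t) + B * card (S \<inter> {q * t..<(q + n) * t})" for q n
  proof (induction n)
    case (Suc n)
    let ?J = "{(q + n) * t..<(q + n + 1) * t}"
    have split: "{q * t..<(q + Suc n) * t} = {q * t..<(q + n) * t} \<union> ?J"
      by (auto simp: algebra_simps)
    have "(\<Sum>i = q * t..<(q + Suc n) * t. u i) = (\<Sum>i = q * t..<(q + n) * t. u i) + sum u ?J"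
      unfolding split by (rule sum.union_disjoint) auto
    moreover have "card (S \<inter> {q * t..<(q + Suc n) * t})
        = card (S \<inter> {q * t..<(q + n) * t}) + card (S \<inter> ?J)"
      unfolding split Int_Un_distrib by (rule card_Un_disjoint) auto
    moreover have "\<bar>sum u ?J\<bar> \<le> \<alpha> * card ?J + B * card (S \<inter> ?J)"
      using block[of "q + n"] by (intro block_sum_bound \<alpha> B) auto
    ultimately show ?case using Suc.IH by (simp add: algebra_simps)
  qed simp
  define q r where "q = a div t" and "r = (a + N) div t"
  have qr: "q \<le> r" by (simp add: q_def r_def div_le_mono)
  have q: "q * t \<le> a" "a - q * t \<le> t" and r: "r * t \<le> a + N" "a + N - r * t \<le> t"
    using mod_less_divisor[OF t] by (auto simp: q_def r_def minus_div_mult_eq_mod less_imp_le)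
  have qr': "q * t \<le> r * t" using qr by simp
  have dist: "(\<Sum>i = a..<a + N. u i)
      = (\<Sum>i = q * t..<r * t. u i) + (\<Sum>i = r * t..<a + N. u i) - (\<Sum>i = q * t..<a. u i)"
    using sum.atLeastLessThan_concat[OF q(1), of "a + N" u]
      sum.atLeastLessThan_concat[OF qr' r(1), of u] by simp
  have "\<bar>\<Sum>i = q * t..<r * t. u i\<bar> \<le> \<alpha> * real ((r - q) * t) + B * card (S \<inter> {q * t..<r * t})"
    using blocks[of q "r - q"] qr by simp
  also have "\<dots> \<le> \<alpha> * real (N + t) + B * (real (card (S \<inter> {a..<a + N})) + real t)"
  proof (intro add_mono mult_left_mono \<alpha> B0)
    have "(r - q) * t \<le> N + t" using q r by (simp add: diff_mult_distrib)
    then show "real ((r - q) * t) \<le> real (N + t)" by (rule of_nat_mono)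
    have "S \<inter> {q * t..<r * t} \<subseteq> (S \<inter> {a..<a + N}) \<union> {q * t..<a}" using r by auto
    then have "card (S \<inter> {q * t..<r * t}) \<le> card (S \<inter> {a..<a + N}) + card {q * t..<a}"
      by (intro order.trans[OF card_mono card_Un_le]) auto
    then show "real (card (S \<inter> {q * t..<r * t})) \<le> real (card (S \<inter> {a..<a + N})) + real t"
      using q by simp
  qed
  finally show ?thesis
    using short[OF q(1)] short[of "r * t" "a + N"] q r unfolding dist by (simp add: algebra_simps)
qed

text \<open>Maximal inequality on the integers: bad starting points are covered from left to right by
  disjoint windows of high density.\<close>

lemma maximal_inequality_nat:
  fixes \<theta> :: real and S :: "nat set" and L :: nat
  assumes \<theta>: "0 \<le> \<theta>"
  defines "bad \<equiv> {i. \<exists>N\<ge>1. N \<le> L \<and> \<theta> * N < card (S \<inter> {i..<i + N})}"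
  shows "\<theta> * card (bad \<inter> {a..<M}) \<le> card (S \<inter> {a..<M + L})"
proof (induction "M - a" arbitrary: a rule: less_induct)
  case less
  show ?case
  proof (cases "a < M")
    case False
    then show ?thesis by simp
  next
    case aM: True
    show ?thesis
    proof (cases "a \<in> bad")
      case False
      then have "bad \<inter> {a..<M} = bad \<inter> {Suc a..<M}"
        using aM by (auto simp: Suc_le_eq order.order_iff_strict)
      moreover have "card (S \<inter> {Suc a..<M + L}) \<le> card (S \<inter> {a..<M + L})"
        by (intro card_mono) auto
      moreover have "\<theta> * card (bad \<inter> {Suc a..<M}) \<le> card (S \<inter> {Suc a..<M + L})"
        using less[of "Suc a"] aM by simp
      ultimately show ?thesis by simp
    next
      case True
      then obtain N where N: "1 \<le> N" "N \<le> L" "\<theta> * N < card (S \<inter> {a..<a + N})"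
        unfolding bad_def by blast
      have "bad \<inter> {a..<M} \<subseteq> {a..<a + N} \<union> (bad \<inter> {a + N..<M})" by auto
      then have "card (bad \<inter> {a..<M}) \<le> card {a..<a + N} + card (bad \<inter> {a + N..<M})"
        by (intro order.trans[OF card_mono card_Un_le]) auto
      then have "card (bad \<inter> {a..<M}) \<le> N + card (bad \<inter> {a + N..<M})" by simp
      then have "\<theta> * card (bad \<inter> {a..<M}) \<le> \<theta> * real (N + card (bad \<inter> {a + N..<M}))"
        by (intro mult_left_mono \<theta>) simp
      also have "\<dots> = \<theta> * N + \<theta> * card (bad \<inter> {a + N..<M})" by (simp add: distrib_left)
      also have "\<dots> \<le> card (S \<inter> {a..<a + N}) + card (S \<inter> {a + N..<M + L})"
        unfolding of_nat_add
        by (intro add_mono less_imp_le[OF N(3)] less) (use N(1) aM in linarith)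
      also have "\<dots> = real (card (S \<inter> {a..<a + N} \<union> S \<inter> {a + N..<M + L}))"
        by (subst card_Un_disjoint) auto
      also have "S \<inter> {a..<a + N} \<union> S \<inter> {a + N..<M + L} = S \<inter> {a..<M + L}"
        using N aM by auto
      finally show ?thesis by simp
    qed
  qed
qed

section \<open>Weak-star limits of empirical measures\<close>

lemma empirical_measure_conv_distr:
  assumes "0 < n"
  shows "empirical_measure f x n
    = distr (measure_pmf (pmf_of_set {..<n})) borel (\<lambda>i. (f ^^ i) x)"
proof (rule measure_eqI)
  fix A assume "A \<in> sets (empirical_measure f x n)"
  then have A: "A \<in> sets borel" by simp
  have ne: "{..<n} \<noteq> {}" using assms by auto
  have "(\<Sum>i<n. emeasure (return borel ((f ^^ i) x)) A) = (\<Sum>i<n. indicator {i. (f ^^ i) x \<in> A} i)"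
    using A by (intro sum.cong) (auto simp: indicator_def)
  also have "\<dots> = of_nat (card ({..<n} \<inter> {i. (f ^^ i) x \<in> A}))"
    by (simp add: indicator_def sum.If_cases)
  finally have "emeasure (empirical_measure f x n) A
      = of_nat (card ({..<n} \<inter> {i. (f ^^ i) x \<in> A})) / of_nat n"
    using A by (simp add: emeasure_empirical_measure)
  also have "\<dots> = emeasure (distr (measure_pmf (pmf_of_set {..<n})) borel (\<lambda>i. (f ^^ i) x)) A"
    using A ne assms
    by (simp add: emeasure_distr emeasure_pmf_of_set vimage_def ennreal_of_nat_eq_real_of_nat
        divide_ennreal)
  finally show "emeasure (empirical_measure f x n) A
      = emeasure (distr (measure_pmf (pmf_of_set {..<n})) borel (\<lambda>i. (f ^^ i) x)) A" .
qed simp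

lemma integral_empirical_measure:
  fixes g :: "'a::topological_space \<Rightarrow> real"
  assumes "0 < n" "g \<in> borel_measurable borel"
  shows "integral\<^sup>L (empirical_measure f x n) g = (\<Sum>i<n. g ((f ^^ i) x)) / n"
  using assms by (simp add: empirical_measure_conv_distr integral_distr integral_pmf_of_set lessThan_empty_iff)

text \<open>The half of the portmanteau theorem that concerns open sets: the limit gives an open set at most
  its asymptotic visiting frequency. The indicator of \<open>U\<close> is the increasing limit of the continuous
  functions \<open>min 1 (k * infdist y (- U))\<close>.\<close>

lemma weak_star_limit_open_le:
  fixes f :: "'a::metric_space \<Rightarrow> 'a" and c d :: real
  assumes "prob_space \<mu>" and sets: "sets \<mu> = sets borel"
    and lim: "weak_star_subseq_limit (empirical_measure f x) \<mu>"
    and U: "open U" and freq: "\<And>n. real (card {i. i < n \<and> (f ^^ i) x \<in> U}) \<le> c * n + d"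
  shows "measure \<mu> U \<le> c"
proof -
  interpret prob_space \<mu> by fact
  obtain r where r: "strict_mono r" "weak_star_conv (empirical_measure f x \<circ> r) \<mu>"
    using lim unfolding weak_star_subseq_limit_def by blast
  have below: "integral\<^sup>L \<mu> g \<le> c"
    if g: "continuous_on UNIV g" "\<And>y. g y \<le> indicator U y" for g
  proof (rule LIMSEQ_le)
    show "(\<lambda>n. integral\<^sup>L (empirical_measure f x (r n)) g) \<longlonglongrightarrow> integral\<^sup>L \<mu> g"
      using r(2) g(1) by (simp add: weak_star_conv_def)
    have "(\<lambda>n. c + d / real n) \<longlonglongrightarrow> c + 0"
      by (intro tendsto_intros lim_const_over_n)
    then show "(\<lambda>n. c + d / real (r n)) \<longlonglongrightarrow> c"
      using LIMSEQ_subseq_LIMSEQ[OF _ r(1)] by (fastforce simp: o_def)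
    have "integral\<^sup>L (empirical_measure f x (r n)) g \<le> c + d / real (r n)" if "n \<ge> 1" for n
    proof -
      have pos: "0 < r n" using seq_suble[OF r(1), of n] that by simp
      have "(\<Sum>i<r n. g ((f ^^ i) x)) \<le> (\<Sum>i<r n. indicator U ((f ^^ i) x))"
        by (intro sum_mono g(2))
      also have "\<dots> = real (card {i. i < r n \<and> (f ^^ i) x \<in> U})"
        by (simp add: indicator_def sum.If_cases Int_def)
      also have "\<dots> \<le> c * r n + d" by (rule freq)
      finally have "(\<Sum>i<r n. g ((f ^^ i) x)) / r n \<le> (c * r n + d) / r n"
        by (rule divide_right_mono) simp
      then show ?thesis
        using pos g(1) by (simp add: integral_empirical_measure borel_measurable_continuous_onI add_divide_distrib)
    qed
    then show "\<exists>N. \<forall>n\<ge>N. integral\<^sup>L (empirical_measure f x (r n)) g \<le> c + d / real (r n)"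
      by blast
  qed
  have spc: "space \<mu> = UNIV" using sets_eq_imp_space_eq[OF sets] by simp
  show ?thesis
  proof (cases "U = UNIV")
    case True
    \<comment> \<open>Separate, because the distance to the empty set is \<open>0\<close> by convention.\<close>
    then have "integral\<^sup>L \<mu> (\<lambda>_. 1) \<le> c" by (intro below) auto
    then show ?thesis using True prob_space spc by simp
  next
    case False
    define g where "g k y = min 1 (real k * infdist y (- U))" for k y
    have cont: "continuous_on UNIV (g k)" for k
      unfolding g_def by (intro continuous_intros)
    have out: "infdist y (- U) = 0" if "y \<notin> U" for y
      using that by simp
    have le: "integral\<^sup>L \<mu> (g k) \<le> c" for k
      by (rule below[OF cont]) (auto simp: g_def indicator_def out)
    have "(\<lambda>k. integral\<^sup>L \<mu> (g k)) \<longlonglongrightarrow> integral\<^sup>L \<mu> (indicator U)"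
    proof (rule integral_dominated_convergence[where w = "\<lambda>_. 1"])
      show "AE y in \<mu>. (\<lambda>k. g k y) \<longlonglongrightarrow> indicator U y"
      proof (rule AE_I2)
        fix y
        show "(\<lambda>k. g k y) \<longlonglongrightarrow> indicator U y"
        proof (cases "y \<in> U")
          case True
          then have pos: "0 < infdist y (- U)"
            using U False infdist_pos_not_in_closed[of "- U" y] by auto
          obtain K where K: "1 < real K * infdist y (- U)" using reals_Archimedean3[OF pos] by blast
          have "g k y = 1" if "k \<ge> K" for k
          proof -
            have "real K * infdist y (- U) \<le> real k * infdist y (- U)"
              using that pos by (intro mult_right_mono) auto
            then show ?thesis using K unfolding g_def by linarith
          qed
          then show ?thesis using True
            by (intro tendsto_eventually) (auto simp: eventually_sequentially)
        qed (simp add: g_def out)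
      qed
      show "g k \<in> borel_measurable \<mu>" for k
        using borel_measurable_continuous_onI[OF cont] sets by (simp cong: measurable_cong_sets)
      show "indicator U \<in> borel_measurable \<mu>"
        using U sets by (intro borel_measurable_indicator) simp
    qed (auto simp: g_def infdist_nonneg)
    moreover have "integral\<^sup>L \<mu> (indicator U :: 'a \<Rightarrow> real) = measure \<mu> U" by (simp add: spc)
    ultimately show ?thesis
      using le by (intro LIMSEQ_le_const2) auto
  qed
qed

lemma AE_not_of_small_open_cover:
  fixes \<mu> :: "'a::topological_space measure"
  assumes "prob_space \<mu>" and sets: "sets \<mu> = sets borel"
    and cover: "\<And>e::real. 0 < e \<Longrightarrow> \<exists>U. open U \<and> {x. P x} \<subseteq> U \<and> measure \<mu> U \<le> e"
  shows "AE x in \<mu>. \<not> P x"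
proof -
  interpret prob_space \<mu> by fact
  obtain U where U: "\<And>n. open (U n)" "\<And>n. {x. P x} \<subseteq> U n"
      "\<And>n. measure \<mu> (U n) \<le> inverse (real (Suc n))"
    using cover[of "inverse (real (Suc _))"] by (metis inverse_positive_iff_positive of_nat_0_less_iff zero_less_Suc)
  have m: "U n \<in> sets \<mu>" for n using U(1) sets by simp
  then have mI: "(\<Inter>n. U n) \<in> sets \<mu>" by auto
  have "measure \<mu> (\<Inter>n. U n) \<le> inverse (real (Suc n))" for n
    using finite_measure_mono[OF _ m[of n], of "\<Inter>n. U n"] U(3)[of n] by fastforce
  then have "measure \<mu> (\<Inter>n. U n) \<le> 0"
    by (intro LIMSEQ_le_const[OF LIMSEQ_inverse_real_of_nat]) auto
  then have "emeasure \<mu> (\<Inter>n. U n) = 0"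
    by (simp add: emeasure_eq_measure measure_le_0_iff)
  then show ?thesis
    using mI U(2) by (intro AE_I[of _ _ "\<Inter>n. U n"]) auto
qed

section \<open>Birkhoff averages and density of almost every orbit\<close>

lemma sum_along_shifted_orbit:
  "(\<Sum>j<N. \<phi> ((f ^^ j) ((f ^^ i) x))) = (\<Sum>j = i..<i + N. \<phi> ((f ^^ j) x))"
  using sum.shift_bounds_nat_ivl[of "\<lambda>j. \<phi> ((f ^^ j) x)" 0 i N]
  by (simp add: funpow_add lessThan_atLeast0 add.commute)

lemma continuous_on_funpow:
  fixes f :: "'a::topological_space \<Rightarrow> 'a"
  assumes "continuous_on UNIV f"
  shows "continuous_on UNIV (f ^^ n)"
  by (induction n) (auto intro: continuous_on_compose2[OF assms])

text \<open>Here \<open>S n\<close> is a set of times of small density, \<open>D n\<close> bounds this density, and blocks of length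
  \<open>t n\<close> not contained in \<open>S n\<close> have averages of size at most \<open>\<alpha> n\<close>.\<close>

lemma AE_averages_tendsto_0:
  fixes f :: "'a::metric_space \<Rightarrow> 'a" and \<phi> :: "'a \<Rightarrow> real" and S :: "nat \<Rightarrow> nat set"
  assumes "prob_space \<mu>" and sets: "sets \<mu> = sets borel"
    and lim: "weak_star_subseq_limit (empirical_measure f x\<^sub>0) \<mu>"
    and f: "continuous_on UNIV f" and \<phi>: "continuous_on UNIV \<phi>" and B: "\<And>x. \<bar>\<phi> x\<bar> \<le> B"
    and D: "D \<longlonglongrightarrow> 0" and S: "\<And>n M. real (card (S n \<inter> {..<M})) \<le> D n * real M"
    and t: "\<And>n. 0 < t n" and \<alpha>: "\<alpha> \<longlonglongrightarrow> 0" "\<And>n. 0 \<le> \<alpha> n"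
    and block: "\<And>n k. \<not> {k * t n..<(k + 1) * t n} \<subseteq> S n \<Longrightarrow>
       \<bar>\<Sum>i = k * t n..<(k + 1) * t n. \<phi> ((f ^^ i) x\<^sub>0)\<bar> \<le> \<alpha> n * real (t n)"
  shows "AE x in \<mu>. (\<lambda>n. (\<Sum>i<n. \<phi> ((f ^^ i) x)) / real n) \<longlonglongrightarrow> 0"
    and "integral\<^sup>L \<mu> \<phi> = 0"
proof -
  interpret prob_space \<mu> by fact
  have window: "\<bar>\<Sum>j<N. \<phi> ((f ^^ j) ((f ^^ i) x\<^sub>0))\<bar>
      \<le> \<alpha> n * N + B * card (S n \<inter> {i..<i + N}) + (3 * B + \<alpha> n) * t n" for i N n
    unfolding sum_along_shifted_orbit by (rule window_sum_bound[OF t \<alpha>(2) B block])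
  have "0 \<le> B" using B[of x\<^sub>0] by linarith
  have "\<exists>U. open U \<and> {x. \<forall>K. \<exists>N\<ge>K. \<eta> * real N < \<bar>\<Sum>i<N. \<phi> ((f ^^ i) x)\<bar>} \<subseteq> U \<and> measure \<mu> U \<le> e"
    if \<eta>: "0 < \<eta>" and e: "0 < e" for \<eta> e :: real
  proof -
    \<comment> \<open>A large window average forces \<open>S n\<close> to have density above \<open>\<theta>\<close> in that window. The summand
      \<open>1\<close> avoids division by zero.\<close>
    define \<theta> where "\<theta> = \<eta> / (2 * (B + 1))"
    have \<theta>: "0 < \<theta>" using \<eta> \<open>0 \<le> B\<close> by (simp add: \<theta>_def)
    have "\<forall>\<^sub>F n in sequentially. D n < \<theta> * e \<and> \<alpha> n < \<eta> / 4"
      using order_tendstoD(2)[OF D, of "\<theta> * e"] order_tendstoD(2)[OF \<alpha>(1), of "\<eta> / 4"] \<theta> e \<eta>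
      by (simp add: eventually_conj_iff)
    then obtain n where n: "D n < \<theta> * e" "\<alpha> n < \<eta> / 4"
      using eventually_happens'[OF sequentially_bot] by blast
    \<comment> \<open>From length \<open>K\<close> on, the incomplete blocks at both ends of a window are negligible.\<close>
    obtain K0 :: nat where "(3 * B + \<alpha> n) * t n / (\<eta> / 4) < K0" using reals_Archimedean2 by blast
    then have K0: "(3 * B + \<alpha> n) * t n < \<eta> / 4 * K0" using \<eta> by (simp add: field_simps)
    define K where "K = max 1 K0"
    have K: "1 \<le> K" "(3 * B + \<alpha> n) * t n < \<eta> / 4 * K"
      using order.strict_trans2[OF K0, of "\<eta> / 4 * K"] \<eta> by (auto simp: K_def)
    \<comment> \<open>The bound \<open>L\<close> on the window length is needed for the maximal inequality; the resulting bound on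
      the measure does not depend on \<open>L\<close>.\<close>
    define U where "U L = {x. \<exists>N\<in>{K..L}. \<eta> * real N < \<bar>\<Sum>i<N. \<phi> ((f ^^ i) x)\<bar>}" for L
    have "U L = (\<Union>N\<in>{K..L}. {x. \<eta> * real N < \<bar>\<Sum>i<N. \<phi> ((f ^^ i) x)\<bar>})" for L
      by (auto simp: U_def)
    moreover have "open {x. \<eta> * real N < \<bar>\<Sum>i<N. \<phi> ((f ^^ i) x)\<bar>}" for N
      by (intro open_Collect_less continuous_intros continuous_on_compose2[OF \<phi>] continuous_on_funpow f) auto
    ultimately have openU: "open (U L)" for L by auto
    have U_le: "measure \<mu> (U L) \<le> e" for L
    proof -
      have "real (card {i. i < M \<and> (f ^^ i) x\<^sub>0 \<in> U L}) \<le> D n / \<theta> * M + D n / \<theta> * L" for M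
      proof -
        let ?bad = "{i. \<exists>N\<ge>1. N \<le> L \<and> \<theta> * N < card (S n \<inter> {i..<i + N})}"
        have "i \<in> ?bad" if i: "(f ^^ i) x\<^sub>0 \<in> U L" for i
        proof -
          obtain N where N: "K \<le> N" "N \<le> L" "\<eta> * real N < \<bar>\<Sum>j<N. \<phi> ((f ^^ j) ((f ^^ i) x\<^sub>0))\<bar>"
            using i by (auto simp: U_def)
          let ?c = "real (card (S n \<inter> {i..<i + N}))"
          have "\<eta> / 4 * K \<le> \<eta> / 4 * N" using N(1) \<eta> by simp
          moreover have "\<alpha> n * N \<le> \<eta> / 4 * N"
            by (rule mult_right_mono[OF less_imp_le[OF n(2)]]) simp
          ultimately have "\<eta> / 2 * N < B * ?c"
            using window[of i N n] N(3) K(2) by simp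
          also have "\<dots> \<le> (B + 1) * ?c" by (intro mult_right_mono) auto
          finally have "\<theta> * N < ?c" using \<open>0 \<le> B\<close> by (simp add: \<theta>_def field_simps)
          moreover have "1 \<le> N" using N(1) K(1) by linarith
          ultimately show ?thesis using N(2) by blast
        qed
        then have "card {i. i < M \<and> (f ^^ i) x\<^sub>0 \<in> U L} \<le> card (?bad \<inter> {0..<M})"
          by (intro card_mono) auto
        then have "\<theta> * card {i. i < M \<and> (f ^^ i) x\<^sub>0 \<in> U L} \<le> \<theta> * card (?bad \<inter> {0..<M})"
          using \<theta> by simp
        also have "\<dots> \<le> card (S n \<inter> {0..<M + L})"
          using \<theta> by (intro maximal_inequality_nat) simp
        also have "\<dots> \<le> D n * real (M + L)" using S[of n "M + L"] by (simp add: lessThan_atLeast0)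
        finally show ?thesis using \<theta> by (simp add: field_simps)
      qed
      then have "measure \<mu> (U L) \<le> D n / \<theta>"
        by (rule weak_star_limit_open_le[OF \<open>prob_space \<mu>\<close> sets lim openU])
      also have "\<dots> \<le> e" using n(1) \<theta> by (simp add: field_simps)
      finally show ?thesis .
    qed
    have "(\<lambda>L. measure \<mu> (U L)) \<longlonglongrightarrow> measure \<mu> (\<Union>L. U L)"
      using openU sets
      by (intro finite_Lim_measure_incseq) (fastforce simp: incseq_def U_def)+
    then have "measure \<mu> (\<Union>L. U L) \<le> e"
      using U_le by (intro LIMSEQ_le_const2) auto
    moreover have "{x. \<forall>K. \<exists>N\<ge>K. \<eta> * real N < \<bar>\<Sum>i<N. \<phi> ((f ^^ i) x)\<bar>} \<subseteq> (\<Union>L. U L)"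
    proof
      fix x assume "x \<in> {x. \<forall>K. \<exists>N\<ge>K. \<eta> * real N < \<bar>\<Sum>i<N. \<phi> ((f ^^ i) x)\<bar>}"
      then obtain N where "K \<le> N" "\<eta> * real N < \<bar>\<Sum>i<N. \<phi> ((f ^^ i) x)\<bar>" by blast
      then have "x \<in> U N" unfolding U_def by auto
      then show "x \<in> (\<Union>L. U L)" by blast
    qed
    ultimately show ?thesis using open_UN[of UNIV U] openU by blast
  qed
  then have "AE x in \<mu>. \<not> (\<forall>K. \<exists>N\<ge>K. \<eta> * real N < \<bar>\<Sum>i<N. \<phi> ((f ^^ i) x)\<bar>)" if "0 < \<eta>" for \<eta>
    using that by (intro AE_not_of_small_open_cover \<open>prob_space \<mu>\<close> sets)
  then have "AE x in \<mu>. \<forall>k. \<not> (\<forall>K. \<exists>N\<ge>K. inverse (real (Suc k)) * real N < \<bar>\<Sum>i<N. \<phi> ((f ^^ i) x)\<bar>)"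
    by (intro AE_all_countable[THEN iffD2] allI) simp
  then show "AE x in \<mu>. (\<lambda>n. (\<Sum>i<n. \<phi> ((f ^^ i) x)) / real n) \<longlonglongrightarrow> 0"
  proof (rule AE_mp, intro AE_I2 impI LIMSEQ_I)
    fix x and e :: real
    assume x: "\<forall>k. \<not> (\<forall>K. \<exists>N\<ge>K. inverse (real (Suc k)) * real N < \<bar>\<Sum>i<N. \<phi> ((f ^^ i) x)\<bar>)"
      and e: "0 < e"
    obtain k where k: "inverse (real (Suc k)) < e" using reals_Archimedean[OF e] by blast
    obtain K where K: "\<And>N. N \<ge> K \<Longrightarrow> \<bar>\<Sum>i<N. \<phi> ((f ^^ i) x)\<bar> \<le> inverse (real (Suc k)) * real N"
      using x by (meson not_le)
    have "norm ((\<Sum>i<N. \<phi> ((f ^^ i) x)) / real N - 0) < e" if "N \<ge> K + 1" for N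
    proof -
      have "\<bar>\<Sum>i<N. \<phi> ((f ^^ i) x)\<bar> / real N \<le> inverse (real (Suc k))"
        using K[of N] that by (simp add: pos_divide_le_eq)
      then show ?thesis using k by simp
    qed
    then show "\<exists>N0. \<forall>N\<ge>N0. norm ((\<Sum>i<N. \<phi> ((f ^^ i) x)) / real N - 0) < e" by blast
  qed
  have avg: "(\<lambda>N. (\<Sum>i<N. \<phi> ((f ^^ i) x\<^sub>0)) / real N) \<longlonglongrightarrow> 0"
  proof (rule LIMSEQ_I)
    fix e :: real assume e: "0 < e"
    have "(\<lambda>n. \<alpha> n + B * D n) \<longlonglongrightarrow> 0 + B * 0" by (intro tendsto_intros \<alpha> D)
    then have "\<forall>\<^sub>F n in sequentially. \<alpha> n + B * D n < e / 2"
      using e by (intro order_tendstoD(2)) auto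
    then obtain n where n: "\<alpha> n + B * D n < e / 2" using eventually_happens'[OF sequentially_bot] by blast
    obtain K :: nat where "(3 * B + \<alpha> n) * t n / (e / 2) < K" using reals_Archimedean2 by blast
    then have K: "(3 * B + \<alpha> n) * t n < e / 2 * K" using e by (simp add: field_simps)
    have "norm ((\<Sum>i<N. \<phi> ((f ^^ i) x\<^sub>0)) / real N - 0) < e" if N: "N \<ge> K + 1" for N
    proof -
      have "\<bar>\<Sum>j<N. \<phi> ((f ^^ j) x\<^sub>0)\<bar> \<le> \<alpha> n * N + B * card (S n \<inter> {..<N}) + (3 * B + \<alpha> n) * t n"
        using window[of 0 N n] by (simp add: lessThan_atLeast0)
      also have "\<dots> \<le> \<alpha> n * N + B * (D n * N) + (3 * B + \<alpha> n) * t n"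
        using mult_left_mono[OF S[of n N] \<open>0 \<le> B\<close>] by linarith
      also have "\<dots> = (\<alpha> n + B * D n) * N + (3 * B + \<alpha> n) * t n" by (simp add: algebra_simps)
      also have "\<dots> < e / 2 * N + e / 2 * N"
      proof (rule add_strict_mono)
        show "(\<alpha> n + B * D n) * N < e / 2 * N" using n N by (intro mult_strict_right_mono) auto
        show "(3 * B + \<alpha> n) * t n < e / 2 * N"
          using N e by (intro order.strict_trans2[OF K] mult_left_mono) auto
      qed
      finally show ?thesis using N by (simp add: field_simps)
    qed
    then show "\<exists>N0. \<forall>N\<ge>N0. norm ((\<Sum>i<N. \<phi> ((f ^^ i) x\<^sub>0)) / real N - 0) < e" by blast
  qed
  obtain r where r: "strict_mono r" "weak_star_conv (empirical_measure f x\<^sub>0 \<circ> r) \<mu>"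
    using lim unfolding weak_star_subseq_limit_def by blast
  have "(\<lambda>k. integral\<^sup>L (empirical_measure f x\<^sub>0 (r k)) \<phi>) \<longlonglongrightarrow> integral\<^sup>L \<mu> \<phi>"
    using r(2) \<phi> by (simp add: weak_star_conv_def)
  moreover have "(\<lambda>k. integral\<^sup>L (empirical_measure f x\<^sub>0 (r k)) \<phi>) \<longlonglongrightarrow> 0"
  proof (rule Lim_transform_eventually)
    show "(\<lambda>k. (\<Sum>i<r k. \<phi> ((f ^^ i) x\<^sub>0)) / real (r k)) \<longlonglongrightarrow> 0"
      using LIMSEQ_subseq_LIMSEQ[OF avg r(1)] by (simp add: o_def)
    have "0 < r k" if "k \<ge> 1" for k using seq_suble[OF r(1), of k] that by simp
    then show "\<forall>\<^sub>F k in sequentially. (\<Sum>i<r k. \<phi> ((f ^^ i) x\<^sub>0)) / real (r k)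
        = integral\<^sup>L (empirical_measure f x\<^sub>0 (r k)) \<phi>"
      using \<phi> by (intro eventually_sequentiallyI[of 1])
        (simp add: integral_empirical_measure borel_measurable_continuous_onI)
  qed
  ultimately show "integral\<^sup>L \<mu> \<phi> = 0" by (rule LIMSEQ_unique)
qed

text \<open>Again \<open>S n\<close> is a set of times of density at most \<open>D n\<close>; a window of length \<open>L n\<close> starting at \<open>i\<close>
  has \<open>\<delta> n\<close>-dense orbit segment unless \<open>i + t n\<close> lies in \<open>S n\<close>.\<close>

lemma AE_dense_forward_orbit:
  fixes f :: "'a::metric_space \<Rightarrow> 'a" and S :: "nat \<Rightarrow> nat set"
  assumes "prob_space \<mu>" and sets: "sets \<mu> = sets borel"
    and lim: "weak_star_subseq_limit (empirical_measure f x\<^sub>0) \<mu>"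
    and f: "continuous_on UNIV f"
    and D: "D \<longlonglongrightarrow> 0" and S: "\<And>n M. real (card (S n \<inter> {..<M})) \<le> D n * real M"
    and \<delta>: "\<delta> \<longlonglongrightarrow> 0"
    and dense: "\<And>n i. i + t n \<notin> S n \<Longrightarrow> delta_dense (\<delta> n) ((\<lambda>j. (f ^^ j) x\<^sub>0) ` {i..<i + L n})"
  shows "AE x in \<mu>. dense_forward_orbit f x"
proof -
  have "\<exists>U. open U \<and> {x. \<exists>y. \<forall>j. \<eta> < dist ((f ^^ j) x) y} \<subseteq> U \<and> measure \<mu> U \<le> e"
    if \<eta>: "0 < \<eta>" and e: "0 < e" for \<eta> e :: real
  proof -
    have "\<forall>\<^sub>F n in sequentially. D n < e \<and> \<delta> n < \<eta>"
      using order_tendstoD(2)[OF D e] order_tendstoD(2)[OF \<delta> \<eta>] by (simp add: eventually_conj_iff)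
    then obtain n where n: "D n < e" "\<delta> n < \<eta>" using eventually_happens'[OF sequentially_bot] by blast
    \<comment> \<open>The strict inequality \<open>\<eta> < dist\<close> makes this set open; \<open>\<delta> n < \<eta>\<close> makes its points fail to have
      \<open>\<delta> n\<close>-dense orbit segments.\<close>
    define U where "U = {x. \<exists>y. \<forall>j<L n. \<eta> < dist ((f ^^ j) x) y}"
    have "U = (\<Union>y. \<Inter>j<L n. {x. \<eta> < dist ((f ^^ j) x) y})" by (auto simp: U_def)
    moreover have "open {x. \<eta> < dist ((f ^^ j) x) y}" for j y
      by (intro open_Collect_less continuous_intros continuous_on_funpow f)
    ultimately have openU: "open U" by auto
    have "real (card {i. i < M \<and> (f ^^ i) x\<^sub>0 \<in> U}) \<le> D n * M + D n * t n" for M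
    proof -
      have "i + t n \<in> S n" if i: "(f ^^ i) x\<^sub>0 \<in> U" for i
      proof (rule ccontr)
        assume "i + t n \<notin> S n"
        then have UNIV: "(\<Union>s\<in>(\<lambda>j. (f ^^ j) x\<^sub>0) ` {i..<i + L n}. ball s (\<delta> n)) = UNIV"
          using dense unfolding delta_dense_def by blast
        obtain y where y: "\<And>j. j < L n \<Longrightarrow> \<eta> < dist ((f ^^ (j + i)) x\<^sub>0) y"
          using i by (auto simp: U_def funpow_add)
        have "y \<in> (\<Union>s\<in>(\<lambda>j. (f ^^ j) x\<^sub>0) ` {i..<i + L n}. ball s (\<delta> n))"
          unfolding UNIV by simp
        then obtain j where j: "j \<in> {i..<i + L n}" "dist ((f ^^ j) x\<^sub>0) y < \<delta> n"
          by (auto simp del: atLeastLessThan_iff)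
        then have "j - i < L n" by auto
        then show False using y[of "j - i"] j n(2) by auto
      qed
      then have "(\<lambda>i. i + t n) ` {i. i < M \<and> (f ^^ i) x\<^sub>0 \<in> U} \<subseteq> S n \<inter> {..<M + t n}" by auto
      then have "card {i. i < M \<and> (f ^^ i) x\<^sub>0 \<in> U} \<le> card (S n \<inter> {..<M + t n})"
        by (intro card_inj_on_le[where f = "\<lambda>i. i + t n"]) (auto simp: inj_on_def)
      then show ?thesis using S[of n "M + t n"] by (simp add: distrib_left)
    qed
    then have "measure \<mu> U \<le> D n"
      by (rule weak_star_limit_open_le[OF \<open>prob_space \<mu>\<close> sets lim openU])
    then have "measure \<mu> U \<le> e" using n(1) by simp
    moreover have "{x. \<exists>y. \<forall>j. \<eta> < dist ((f ^^ j) x) y} \<subseteq> U" by (auto simp: U_def)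
    ultimately show ?thesis using openU by blast
  qed
  then have "AE x in \<mu>. \<not> (\<exists>y. \<forall>j. \<eta> < dist ((f ^^ j) x) y)" if "0 < \<eta>" for \<eta>
    using that by (intro AE_not_of_small_open_cover \<open>prob_space \<mu>\<close> sets)
  then have "AE x in \<mu>. \<forall>k. \<not> (\<exists>y. \<forall>j. inverse (real (Suc k)) < dist ((f ^^ j) x) y)"
    by (intro AE_all_countable[THEN iffD2] allI) simp
  then show ?thesis
  proof (rule AE_mp, intro AE_I2 impI)
    fix x assume x: "\<forall>k. \<not> (\<exists>y. \<forall>j. inverse (real (Suc k)) < dist ((f ^^ j) x) y)"
    have "y \<in> closure (range (\<lambda>n. (f ^^ n) x))" for y
      unfolding closure_approachable
    proof (intro allI impI)
      fix e :: real assume "0 < e"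
      then obtain k where "inverse (real (Suc k)) < e" using reals_Archimedean by blast
      moreover obtain j where "dist ((f ^^ j) x) y \<le> inverse (real (Suc k))"
        using x by (meson not_le)
      ultimately have "dist ((f ^^ j) x) y < e" by linarith
      then show "\<exists>z\<in>range (\<lambda>n. (f ^^ n) x). dist z y < e" by blast
    qed
    then show "dense_forward_orbit f x" unfolding dense_forward_orbit_def by blast
  qed
qed

text \<open>A null set of the barycentre is null for almost every ergodic component.\<close>

lemma AE_ergodic_decomposition:
  assumes \<mu>: "sets \<mu> = sets borel" and P: "ergodic_decomposition f \<mu> P" and ae: "AE x in \<mu>. Q x"
  shows "AE \<nu> in P. AE x in \<nu>. Q x"
proof -
  have spc: "space \<mu> = UNIV" using sets_eq_imp_space_eq[OF \<mu>] by simp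
  obtain N where N: "{x. \<not> Q x} \<subseteq> N" "emeasure \<mu> N = 0" "N \<in> sets borel"
    using AE_E[OF ae] \<mu> spc by auto
  have "(\<lambda>\<nu>. emeasure \<nu> N) \<in> borel_measurable (prob_algebra borel)"
    unfolding prob_algebra_def
    by (intro measurable_restrict_space1 measurable_emeasure_subprob_algebra N)
  then have "(\<lambda>\<nu>. emeasure \<nu> N) \<in> borel_measurable P"
    using P by (simp add: ergodic_decomposition_def cong: measurable_cong_sets)
  moreover have "(\<integral>\<^sup>+ \<nu>. emeasure \<nu> N \<partial>P) = 0"
    using P N(2,3) unfolding ergodic_decomposition_def by metis
  ultimately have "AE \<nu> in P. emeasure \<nu> N = 0" by (simp add: nn_integral_0_iff_AE)
  moreover have "AE \<nu> in P. ergodic_measure f \<nu>"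
    using P by (simp add: ergodic_decomposition_def)
  ultimately show ?thesis
  proof eventually_elim
    case (elim \<nu>)
    then show ?case using N by (intro AE_I[of _ _ N]) (auto simp: ergodic_measure_def)
  qed
qed

theorem theorem1:
  fixes f :: "'a::metric_space \<Rightarrow> 'a" and \<phi> :: "'a \<Rightarrow> real" and x\<^sub>0 :: 'a and \<mu> :: "'a measure"
  assumes "compact (UNIV :: 'a set)"
    and "\<exists>g. homeomorphism UNIV UNIV f g"
    and "continuous_on UNIV \<phi>"
    and "controlled_long_sparse_tail f \<phi> x\<^sub>0"
    and "prob_space \<mu>" and "sets \<mu> = sets borel"
    and "weak_star_subseq_limit (empirical_measure f x\<^sub>0) \<mu>"
  shows "(AE x in \<mu>. dense_forward_orbit f x \<and>
            (\<lambda>n. (\<Sum>i<n. \<phi> ((f ^^ i) x)) / real n) \<longlonglongrightarrow> integral\<^sup>L \<mu> \<phi>) \<and>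
         (\<forall>P. ergodic_decomposition f \<mu> P \<longrightarrow>
            (AE \<nu> in P. AE x in \<nu>. dense_forward_orbit f x \<and>
               (\<lambda>n. (\<Sum>i<n. \<phi> ((f ^^ i) x)) / real n) \<longlonglongrightarrow> integral\<^sup>L \<mu> \<phi>))"
proof -
  have f: "continuous_on UNIV f" using assms(2) by (auto simp: homeomorphism_def)
  have "bounded (range \<phi>)"
    using compact_continuous_image[OF assms(3,1)] by (rule compact_imp_bounded)
  then obtain B where B: "\<And>x. \<bar>\<phi> x\<bar> \<le> B" by (auto simp: bounded_iff)
  obtain T \<epsilon> R \<delta> \<alpha> where T: "is_scale T" and "controlling_sequence \<epsilon>" and R: "long_sparse_tail T \<epsilon> R"
    and \<delta>: "\<delta> \<longlonglongrightarrow> 0" and \<alpha>: "\<And>n. 0 < \<alpha> n" "\<alpha> \<longlonglongrightarrow> 0"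
    and dense: "\<And>n I. is_component R I \<Longrightarrow> card I = T n \<Longrightarrow> delta_dense (\<delta> n) ((\<lambda>i. (f ^^ i) x\<^sub>0) ` I)"
    and block: "\<And>n k. \<not> scale_interval T n k \<subseteq> tail_from T R (n + 1) \<Longrightarrow>
           (\<Sum>i\<in>scale_interval T n k. \<phi> ((f ^^ i) x\<^sub>0)) / real (T n) \<in> {- \<alpha> n .. \<alpha> n}"
    using assms(4) unfolding controlled_long_sparse_tail_def by metis
  then have \<epsilon>: "\<And>n. 0 < \<epsilon> n" "summable \<epsilon>" by (auto simp: controlling_sequence_def)
  let ?D = "\<lambda>n. tail_density \<epsilon> (Suc n)" and ?S = "\<lambda>n. tail_from T R (Suc n)"
  have D: "?D \<longlonglongrightarrow> 0" using tail_density_tendsto_0[OF \<epsilon>(2)] by (rule LIMSEQ_Suc)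
  have S: "real (card (?S n \<inter> {..<M})) \<le> ?D n * real M" for n M
    by (rule tail_from_density[OF T R \<epsilon>])
  have block': "\<bar>\<Sum>i = k * T n..<(k + 1) * T n. \<phi> ((f ^^ i) x\<^sub>0)\<bar> \<le> \<alpha> n * real (T n)"
    if "\<not> {k * T n..<(k + 1) * T n} \<subseteq> ?S n" for n k
    using block[of n k] that scale_pos[OF T, of n]
    by (simp add: scale_interval_eq[OF T] abs_le_iff field_simps)
  have dense': "delta_dense (\<delta> n) ((\<lambda>j. (f ^^ j) x\<^sub>0) ` {i..<i + 2 * T (Suc n)})"
    if i: "i + T (Suc n) \<notin> ?S n" for n i
  proof -
    obtain J where J: "is_component R J" "card J = T n" "J \<subseteq> {i..<i + 2 * T (Suc n)}"
      using component_ahead[OF T R i] .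
    then show ?thesis using dense[OF J(1,2)] unfolding delta_dense_def by blast
  qed
  note averages = AE_averages_tendsto_0[OF assms(5-7) f assms(3) B D S scale_pos[OF T] \<alpha>(2)
      less_imp_le[OF \<alpha>(1)] block']
  have "AE x in \<mu>. dense_forward_orbit f x"
    by (rule AE_dense_forward_orbit[OF assms(5-7) f D S \<delta> dense'])
  then have "AE x in \<mu>. dense_forward_orbit f x \<and>
      (\<lambda>n. (\<Sum>i<n. \<phi> ((f ^^ i) x)) / real n) \<longlonglongrightarrow> integral\<^sup>L \<mu> \<phi>"
    using averages by simp
  then show ?thesis using AE_ergodic_decomposition[OF assms(6)] by blast
qed

end
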